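(* Let $R$ be a commutative ring, let $M$, $N$, $P$ be $R$-Lie algebras, and let $(M\xrightarrow{\mu}P,\psi_M)$ and $(N\xrightarrow{\nu}P,\psi_N)$ be crossed modules of $R$-Lie algebras. Define induced actions $\psi^M_N\colon M\times N\to N$ by $\psi^M_N(m,n):=\psi_N(\mu(m),n)$ and $\psi^N_M\colon N\times M\to M$ by $\psi^N_M(n,m):=\psi_M(\nu(n),m)$. Then the actions $\psi^M_N$ and $\psi^N_M$ are compatible.
   Context: An $R$-Lie algebra is an $R$-module with an $R$-bilinear bracket satisfying $[x,x]=0$ and the Jacobi identity. An action of an $R$-Lie algebra $P$ on an $R$-Lie algebra $M$ is an $R$-bilinear map $\psi\colon P\times M\to M$, $(p,m)\mapsto {}^{p}m$, such that ${}^{[p,p']}m={}^{p}({}^{p'}m)-{}^{p'}({}^{p}m)$ and ${}^{p}[m,m']=[{}^{p}m,m']+[m,{}^{p}m']$ for all $p,p'\in P$, $m,m'\in M$. An action of $M$ on $N$, $(m,n)\mapsto{}^{m}n$, and an action of $N$ on $M$, $(n,m)\mapsto{}^{n}m$, are compatible if for all $m,m'\in M$, $n,n'\in N$: ${}^{({}^{n}m)}n'=[n',{}^{m}n]$ and ${}^{({}^{m}n)}m'=[m',{}^{n}m]$. A crossed module of $R$-Lie algebras $(M\xrightarrow{\partial}P,\psi)$ consists of a Lie algebra morphism $\partial\colon M\to P$ and an action $\psi$ of $P$ on $M$ such that ${}^{\partial(m)}m'=[m,m']$ and $\partial({}^{p}m)=[p,\partial(m)]$ for all $m,m'\in M$,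 $p\in P$. *)

theory Defs
  imports "HOL-Algebra.Module"
begin

text \<open>
  Lie algebras over a commutative ring \<open>R\<close> are modules in the sense of HOL-Algebra, extended by
  a bracket. As for \<^locale>\<open>module\<close>, the fields \<open>mult\<close> and \<open>one\<close> of the underlying record
  carry no meaning here. All conditions are imposed on carriers only.
\<close>

record ('a, 'b) lie_algebra = "('a, 'b) module" +
  bracket :: "'b \<Rightarrow> 'b \<Rightarrow> 'b"

definition linear_on ::
  "('a, 'e) ring_scheme \<Rightarrow> ('a, 'b, 'f) module_scheme \<Rightarrow> ('a, 'c, 'g) module_scheme
    \<Rightarrow> ('b \<Rightarrow> 'c) \<Rightarrow> bool"
  where "linear_on R A B f \<longleftrightarrow>
    f \<in> carrier A \<rightarrow> carrier B \<and>
    (\<forall>x\<in>carrier A. \<forall>y\<in>carrier A. f (x \<oplus>\<^bsub>A\<^esub> y) = f x \<oplus>\<^bsub>B\<^esub> f y) \<and>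
    (\<forall>r\<in>carrier R. \<forall>x\<in>carrier A. f (r \<odot>\<^bsub>A\<^esub> x) = r \<odot>\<^bsub>B\<^esub> f x)"

definition bilinear_on ::
  "('a, 'e) ring_scheme \<Rightarrow> ('a, 'b, 'f) module_scheme \<Rightarrow> ('a, 'c, 'g) module_scheme
    \<Rightarrow> ('a, 'd, 'h) module_scheme \<Rightarrow> ('b \<Rightarrow> 'c \<Rightarrow> 'd) \<Rightarrow> bool"
  where "bilinear_on R A B C f \<longleftrightarrow>
    (\<forall>x\<in>carrier A. linear_on R B C (\<lambda>y. f x y)) \<and>
    (\<forall>y\<in>carrier B. linear_on R A C (\<lambda>x. f x y))"

locale lie_algebra = module R L
  for R :: "('a, 'e) ring_scheme" (structure)
    and L :: "('a, 'b, 'f) lie_algebra_scheme" (structure) +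
  assumes bracket_bilinear: "bilinear_on R L L L (bracket L)"
    and bracket_self: "x \<in> carrier L \<Longrightarrow> bracket L x x = \<zero>\<^bsub>L\<^esub>"
    and jacobi: "\<lbrakk>x \<in> carrier L; y \<in> carrier L; z \<in> carrier L\<rbrakk> \<Longrightarrow>
      bracket L x (bracket L y z) \<oplus>\<^bsub>L\<^esub> bracket L y (bracket L z x)
        \<oplus>\<^bsub>L\<^esub> bracket L z (bracket L x y) = \<zero>\<^bsub>L\<^esub>"

definition lie_morphism ::
  "('a, 'e) ring_scheme \<Rightarrow> ('a, 'b, 'f) lie_algebra_scheme \<Rightarrow> ('a, 'c, 'g) lie_algebra_scheme
    \<Rightarrow> ('b \<Rightarrow> 'c) \<Rightarrow> bool"
  where "lie_morphism R K L f \<longleftrightarrow>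
    linear_on R K L f \<and>
    (\<forall>x\<in>carrier K. \<forall>y\<in>carrier K. f (bracket K x y) = bracket L (f x) (f y))"

text \<open>\<open>\<psi> p m\<close> is written \<open>\<^sup>pm\<close> in the mathematical literature.\<close>

locale lie_action = P: lie_algebra R P + M: lie_algebra R M
  for R :: "('a, 'e) ring_scheme"
    and P :: "('a, 'p, 'f) lie_algebra_scheme"
    and M :: "('a, 'm, 'g) lie_algebra_scheme"
    and \<psi> :: "'p \<Rightarrow> 'm \<Rightarrow> 'm" +
  assumes action_bilinear: "bilinear_on R P M M \<psi>"
    and action_bracket_left: "\<lbrakk>p \<in> carrier P; p' \<in> carrier P; m \<in> carrier M\<rbrakk> \<Longrightarrow>
      \<psi> (bracket P p p') m = \<psi> p (\<psi> p' m) \<ominus>\<^bsub>M\<^esub> \<psi> p' (\<psi> p m)"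
    and action_bracket_right: "\<lbrakk>p \<in> carrier P; m \<in> carrier M; m' \<in> carrier M\<rbrakk> \<Longrightarrow>
      \<psi> p (bracket M m m') = bracket M (\<psi> p m) m' \<oplus>\<^bsub>M\<^esub> bracket M m (\<psi> p m')"

text \<open>
  Compatibility is a relation between actions, so being actions is part of it:
  \<open>\<alpha>\<close> is an action of \<open>M\<close> on \<open>N\<close>, and \<open>\<beta>\<close> is an action of \<open>N\<close> on \<open>M\<close>.
\<close>

locale compatible_actions = MN: lie_action R M N \<alpha> + NM: lie_action R N M \<beta>
  for R :: "('a, 'e) ring_scheme"
    and M :: "('a, 'm, 'f) lie_algebra_scheme"
    and N :: "('a, 'n, 'g) lie_algebra_scheme"
    and \<alpha> :: "'m \<Rightarrow> 'n \<Rightarrow> 'n"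
    and \<beta> :: "'n \<Rightarrow> 'm \<Rightarrow> 'm" +
  assumes compatible_left: "\<lbrakk>m \<in> carrier M; n \<in> carrier N; n' \<in> carrier N\<rbrakk> \<Longrightarrow>
      \<alpha> (\<beta> n m) n' = bracket N n' (\<alpha> m n)"
    and compatible_right: "\<lbrakk>m \<in> carrier M; m' \<in> carrier M; n \<in> carrier N\<rbrakk> \<Longrightarrow>
      \<beta> (\<alpha> m n) m' = bracket M m' (\<beta> n m)"

locale lie_crossed_module = lie_action R P M \<psi>
  for R :: "('a, 'e) ring_scheme"
    and M :: "('a, 'm, 'f) lie_algebra_scheme"
    and P :: "('a, 'p, 'g) lie_algebra_scheme"
    and d :: "'m \<Rightarrow> 'p"
    and \<psi> :: "'p \<Rightarrow> 'm \<Rightarrow> 'm" +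
  assumes boundary_morphism: "lie_morphism R M P d"
    and peiffer: "\<lbrakk>m \<in> carrier M; m' \<in> carrier M\<rbrakk> \<Longrightarrow> \<psi> (d m) m' = bracket M m m'"
    and equivariant: "\<lbrakk>p \<in> carrier P; m \<in> carrier M\<rbrakk> \<Longrightarrow> d (\<psi> p m) = bracket P p (d m)"

end

theory Submission
  imports Defs
begin

text \<open>
  Acting through \<open>\<mu>\<close> and \<open>\<nu>\<close> gives actions because both are Lie morphisms. For
  compatibility, equivariance of both boundaries and skew symmetry give
  \<open>\<mu> (\<^sup>nm) = [\<nu> n, \<mu> m] = - [\<mu> m, \<nu> n] = - \<nu> (\<^sup>mn)\<close>,
  and the Peiffer identity turns the action of \<open>- \<nu> (\<^sup>mn)\<close> on \<open>n'\<close> into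
  \<open>- [\<^sup>mn, n'] = [n', \<^sup>mn]\<close>. The other identity is the same one with the two crossed
  modules exchanged.
\<close>

lemma linear_onD:
  assumes "linear_on R A B f"
  shows linear_on_closed: "x \<in> carrier A \<Longrightarrow> f x \<in> carrier B"
    and linear_on_add: "\<lbrakk>x \<in> carrier A; y \<in> carrier A\<rbrakk> \<Longrightarrow> f (x \<oplus>\<^bsub>A\<^esub> y) = f x \<oplus>\<^bsub>B\<^esub> f y"
    and linear_on_smult: "\<lbrakk>r \<in> carrier R; x \<in> carrier A\<rbrakk> \<Longrightarrow> f (r \<odot>\<^bsub>A\<^esub> x) = r \<odot>\<^bsub>B\<^esub> f x"
  using assms by (auto simp: linear_on_def)

lemma linear_on_compose:
  assumes "linear_on R A B f" "linear_on R B C g"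
  shows "linear_on R A C (\<lambda>x. g (f x))"
  using assms by (simp add: linear_on_def Pi_iff)

text \<open>Writing zero as the scalar zero times \<open>x\<close> shows that \<open>f\<close>
  preserves zero; additivity and uniqueness of additive inverses then give the claim. It is needed
  to move a sign out of an action.\<close>

lemma linear_on_minus:
  assumes "module R A" "module R B" "linear_on R A B f" "x \<in> carrier A"
  shows "f (\<ominus>\<^bsub>A\<^esub> x) = \<ominus>\<^bsub>B\<^esub> f x"
proof -
  interpret A: module R A by fact
  interpret B: module R B by fact
  note f = linear_onD[OF assms(3)]
  have "f \<zero>\<^bsub>A\<^esub> = f (\<zero>\<^bsub>R\<^esub> \<odot>\<^bsub>A\<^esub> x)"
    using assms(4) by (simp add: A.smult_l_null)
  also have "\<dots> = \<zero>\<^bsub>B\<^esub>"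
    using assms(4) by (simp only: f A.R.zero_closed B.smult_l_null)
  finally have zero: "f \<zero>\<^bsub>A\<^esub> = \<zero>\<^bsub>B\<^esub>" .
  have "f (\<ominus>\<^bsub>A\<^esub> x) \<oplus>\<^bsub>B\<^esub> f x = \<zero>\<^bsub>B\<^esub>"
    using f(2)[of "\<ominus>\<^bsub>A\<^esub> x" x] assms(4) by (simp add: zero A.l_neg)
  then show ?thesis
    using assms(4) by (intro B.minus_equality[symmetric]) (simp_all add: f)
qed

lemma bilinear_onD:
  assumes "bilinear_on R A B C f"
  shows bilinear_on_right: "x \<in> carrier A \<Longrightarrow> linear_on R B C (f x)"
    and bilinear_on_left: "y \<in> carrier B \<Longrightarrow> linear_on R A C (\<lambda>x. f x y)"
  using assms by (auto simp: bilinear_on_def)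

lemma bilinear_on_closed:
  assumes "bilinear_on R A B C f" "x \<in> carrier A" "y \<in> carrier B"
  shows "f x y \<in> carrier C"
  by (rule linear_on_closed[OF bilinear_on_right[OF assms(1,2)] assms(3)])

lemma bilinear_on_compose_left:
  assumes "linear_on R K A g" "bilinear_on R A B C f"
  shows "bilinear_on R K B C (\<lambda>k. f (g k))"
  unfolding bilinear_on_def
proof (intro conjI ballI)
  show "linear_on R B C (f (g k))" if "k \<in> carrier K" for k
    by (rule bilinear_on_right[OF assms(2) linear_on_closed[OF assms(1) that]])
  show "linear_on R K C (\<lambda>k. f (g k) y)" if "y \<in> carrier B" for y
    by (rule linear_on_compose[OF assms(1) bilinear_on_left[OF assms(2) that]])
qed

context lie_algebra
begin

lemma bracket_closed [simp]:
  "\<lbrakk>x \<in> carrier L; y \<in> carrier L\<rbrakk> \<Longrightarrow> bracket L x y \<in> carrier L"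
  by (rule bilinear_on_closed[OF bracket_bilinear])

text \<open>Polarization of \<open>bracket_self\<close> at \<open>x \<oplus> y\<close>: the two
  diagonal terms vanish, so the mixed terms sum to zero.\<close>

lemma bracket_skew:
  assumes [simp]: "x \<in> carrier L" "y \<in> carrier L"
  shows "bracket L x y = \<ominus>\<^bsub>L\<^esub> bracket L y x"
proof -
  note r = linear_on_add[OF bilinear_on_right[OF bracket_bilinear]]
    and l = linear_on_add[OF bilinear_on_left[OF bracket_bilinear]]
  have "\<zero>\<^bsub>L\<^esub> = bracket L (x \<oplus>\<^bsub>L\<^esub> y) (x \<oplus>\<^bsub>L\<^esub> y)"
    by (simp add: bracket_self)
  also have "\<dots> = bracket L x y \<oplus>\<^bsub>L\<^esub> bracket L y x"
    by (simp add: l r bracket_self[of x] bracket_self[of y] M.a_comm)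
  finally show ?thesis
    by (intro M.minus_equality[symmetric]) simp_all
qed

end

text \<open>Only bilinearity and the law for a bracket of acting elements involve the structure of
  the acting algebra; linearity of \<open>f\<close> handles the former, preservation of brackets the
  latter. The derivation law for each \<open>k\<close> is the old one at \<open>f k\<close>.\<close>

lemma lie_action_pullback:
  assumes "lie_action R P M \<psi>" "lie_algebra R K" "lie_morphism R K P f"
  shows "lie_action R K M (\<lambda>k. \<psi> (f k))"
proof -
  interpret lie_action R P M \<psi> by fact
  have lin: "linear_on R K P f"
    using assms(3) by (simp add: lie_morphism_def)
  have br: "f (bracket K x y) = bracket P (f x) (f y)"
    if "x \<in> carrier K" "y \<in> carrier K" for x y
    using assms(3) that by (simp add: lie_morphism_def)
  show ?thesis
    by (intro lie_action.intro lie_action_axioms.intro assms(2) M.lie_algebra_axioms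
        bilinear_on_compose_left[OF lin action_bilinear])
      (simp_all add: br linear_on_closed[OF lin] action_bracket_left action_bracket_right)
qed

text \<open>Stated for any two crossed modules over the same \<open>P\<close>, so that exchanging
  them yields the second compatibility identity.\<close>

lemma crossed_module_compatible:
  assumes "lie_crossed_module R M P \<mu> \<psi>\<^sub>M" "lie_crossed_module R N P \<nu> \<psi>\<^sub>N"
    and m: "m \<in> carrier M" and n: "n \<in> carrier N" and n': "n' \<in> carrier N"
  shows "\<psi>\<^sub>N (\<mu> (\<psi>\<^sub>M (\<nu> n) m)) n' = bracket N n' (\<psi>\<^sub>N (\<mu> m) n)"
proof -
  interpret M: lie_crossed_module R M P \<mu> \<psi>\<^sub>M by fact
  interpret N: lie_crossed_module R N P \<nu> \<psi>\<^sub>N by fact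
  have \<mu>: "linear_on R M P \<mu>" and \<nu>: "linear_on R N P \<nu>"
    using M.boundary_morphism N.boundary_morphism by (simp_all add: lie_morphism_def)
  have \<mu>m: "\<mu> m \<in> carrier P" and \<nu>n: "\<nu> n \<in> carrier P"
    by (rule linear_on_closed[OF \<mu> m], rule linear_on_closed[OF \<nu> n])
  define k where "k = \<psi>\<^sub>N (\<mu> m) n"
  have k: "k \<in> carrier N"
    unfolding k_def by (rule bilinear_on_closed[OF N.action_bilinear \<mu>m n])
  have "\<mu> (\<psi>\<^sub>M (\<nu> n) m) = \<ominus>\<^bsub>P\<^esub> bracket P (\<mu> m) (\<nu> n)"
    by (simp only: M.equivariant[OF \<nu>n m] M.P.bracket_skew[OF \<nu>n \<mu>m])
  also have "\<dots> = \<ominus>\<^bsub>P\<^esub> \<nu> k"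
    by (simp only: k_def N.equivariant[OF \<mu>m n])
  finally have "\<psi>\<^sub>N (\<mu> (\<psi>\<^sub>M (\<nu> n) m)) n' = \<psi>\<^sub>N (\<ominus>\<^bsub>P\<^esub> \<nu> k) n'"
    by simp
  \<comment> \<open>With \<open>n'\<close> fixed, the action is linear in the acting element, so the
    sign comes out. The prefix \<open>N.M\<close> refers to the algebra acted on in the second
    crossed module, which is \<open>N\<close> itself.\<close>
  also have "\<dots> = \<ominus>\<^bsub>N\<^esub> \<psi>\<^sub>N (\<nu> k) n'"
    using linear_on_minus[OF M.P.module_axioms N.M.module_axioms
        bilinear_on_left[OF N.action_bilinear n'] linear_on_closed[OF \<nu> k]] .
  \<comment> \<open>The Peiffer identity rewrites the left side and skew symmetry the right side;
    both become the negative of \<open>bracket N k n'\<close>.\<close>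
  also have "\<dots> = bracket N n' k"
    by (simp only: N.peiffer[OF k n'] N.M.bracket_skew[OF n' k])
  finally show ?thesis
    by (simp only: k_def)
qed

theorem proposition2p10:
  fixes R :: "('a, 'e) ring_scheme"
    and M :: "('a, 'm, 'f) lie_algebra_scheme"
    and N :: "('a, 'n, 'g) lie_algebra_scheme"
    and P :: "('a, 'p, 'h) lie_algebra_scheme"
    and \<mu> :: "'m \<Rightarrow> 'p" and \<nu> :: "'n \<Rightarrow> 'p"
    and \<psi>\<^sub>M :: "'p \<Rightarrow> 'm \<Rightarrow> 'm" and \<psi>\<^sub>N :: "'p \<Rightarrow> 'n \<Rightarrow> 'n"
  assumes "cring R"
    and "lie_algebra R M" and "lie_algebra R N" and "lie_algebra R P"
    and "lie_crossed_module R M P \<mu> \<psi>\<^sub>M"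
    and "lie_crossed_module R N P \<nu> \<psi>\<^sub>N"
  shows "compatible_actions R M N (\<lambda>m n. \<psi>\<^sub>N (\<mu> m) n) (\<lambda>n m. \<psi>\<^sub>M (\<nu> n) m)"
proof (intro compatible_actions.intro compatible_actions_axioms.intro)
  interpret M: lie_crossed_module R M P \<mu> \<psi>\<^sub>M by fact
  interpret N: lie_crossed_module R N P \<nu> \<psi>\<^sub>N by fact
  show "lie_action R M N (\<lambda>m n. \<psi>\<^sub>N (\<mu> m) n)"
    by (rule lie_action_pullback[OF N.lie_action_axioms assms(2) M.boundary_morphism])
  show "lie_action R N M (\<lambda>n m. \<psi>\<^sub>M (\<nu> n) m)"
    by (rule lie_action_pullback[OF M.lie_action_axioms assms(3) N.boundary_morphism])
\<comment> \<open>The swapped assumptions in the second rule exchange the roles of \<open>M\<close>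
  and \<open>N\<close>, which gives the identity in \<open>M\<close>.\<close>
qed (rule crossed_module_compatible[OF assms(5,6)] crossed_module_compatible[OF assms(6,5)];
    assumption)+

end
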